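(* Let $d \ge 1$ be a fixed integer. There exists a real constant $\delta_d > \log 2$ such that, with $$\alpha_d = \frac{d+1}{((d+1)!)^{1/(d+1)}}\cdot \delta_d, \qquad \beta_d = (d+1)\,\zeta(d+1)^{1/(d+1)},$$ for all sufficiently large integers $n$ we have $$\alpha_d\, n^{d/(d+1)} \le \log \mathsf{p}_d(n) \le \beta_d\, n^{d/(d+1)} + d\log n .$$
   Context: A $d$-dimensional partition is an array $\pi = (\pi_{i_1,\ldots,i_d})_{i_1,\ldots,i_d\ge 1}$ of nonnegative integers with only finitely many nonzero entries such that $\pi_{i_1,\ldots,i_d}\ge \pi_{j_1,\ldots,j_d}$ whenever $i_1\le j_1,\ldots,i_d\le j_d$. Its volume is $|\pi| = \sum_{i_1,\ldots,i_d}\pi_{i_1,\ldots,i_d}$. $\mathsf{p}_d(n)$ denotes the number of $d$-dimensional partitions of volume $n$. $\zeta(s)=\sum_{n\ge1}n^{-s}$ is the Riemann zeta function, and $\log$ is the natural logarithm. *)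

theory Defs
  imports "HOL-Analysis.Analysis"
begin

definition multi_indices :: "nat \<Rightarrow> nat list set" where
  "multi_indices d = {xs. length xs = d \<and> (\<forall>i \<in> set xs. 1 \<le> i)}"

text \<open>
  An array indexed by \<open>multi_indices d\<close> is encoded as a function on all lists that vanishes
  off the index set, so that distinct functions are distinct arrays.
\<close>

definition dim_partition :: "nat \<Rightarrow> (nat list \<Rightarrow> nat) \<Rightarrow> bool" where
  "dim_partition d \<pi> \<longleftrightarrow>
     (\<forall>xs. xs \<notin> multi_indices d \<longrightarrow> \<pi> xs = 0) \<and>
     finite {xs \<in> multi_indices d. \<pi> xs \<noteq> 0} \<and>
     (\<forall>xs \<in> multi_indices d. \<forall>ys \<in> multi_indices d.
        (\<forall>k<d. xs ! k \<le> ys ! k) \<longrightarrow> \<pi> ys \<le> \<pi> xs)"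

text \<open>
  The sum runs over the support because \<open>sum\<close> over the infinite index set is \<open>0\<close> by convention.
\<close>

definition volume :: "nat \<Rightarrow> (nat list \<Rightarrow> nat) \<Rightarrow> nat" where
  "volume d \<pi> = (\<Sum>xs \<in> {xs \<in> multi_indices d. \<pi> xs \<noteq> 0}. \<pi> xs)"

definition num_partitions :: "nat \<Rightarrow> nat \<Rightarrow> nat" where
  "num_partitions d n = card {\<pi>. dim_partition d \<pi> \<and> volume d \<pi> = n}"

text \<open>
  The set counted above is finite, so \<open>card\<close> is a genuine count: every coordinate of an index
  in the support of a partition of volume \<open>n\<close> xs at most \<open>n\<close>.
\<close>

lemma finite_partitions_of_volume: "finite {\<pi>. dim_partition d \<pi> \<and> volume d \<pi> = n}"
proof (rule finite_subset)
  let ?B = "{xs. set xs \<subseteq> {..n} \<and> length xs = d}"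
  let ?F = "{f. \<forall>xs. (xs \<in> ?B \<longrightarrow> f xs \<in> {..n}) \<and> (xs \<notin> ?B \<longrightarrow> f xs = (0::nat))}"
  show "finite ?F"
    by (intro finite_set_of_finite_funs finite_lists_length_eq) auto
  show "{\<pi>. dim_partition d \<pi> \<and> volume d \<pi> = n} \<subseteq> ?F"
  proof clarify
    fix \<pi> xs
    assume p: "dim_partition d \<pi>" and n: "n = volume d \<pi>"
    define S where "S = {xs \<in> multi_indices d. \<pi> xs \<noteq> 0}"
    have fin: "finite S" and off: "\<And>xs. xs \<notin> S \<Longrightarrow> \<pi> xs = 0"
      using p by (auto simp: dim_partition_def S_def)
    have vol: "volume d \<pi> = sum \<pi> S"
      by (simp add: volume_def S_def)
    have "card S = (\<Sum>x\<in>S. 1)" by simp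
    also have "\<dots> \<le> sum \<pi> S"
      by (rule sum_mono) (auto simp: S_def)
    finally have card: "card S \<le> volume d \<pi>" by (simp add: vol)
    have val: "\<pi> xs \<le> volume d \<pi>"
      using off[of xs] member_le_sum[of xs S \<pi>] fin by (cases "xs \<in> S") (auto simp: vol)
    have box: "xs ! k \<le> volume d \<pi>" if "xs \<in> S" "k < d" for k
    proof -
      have len: "length xs = d" using that by (simp add: S_def multi_indices_def)
      have sub: "(\<lambda>m. xs[k := m]) ` {1..xs ! k} \<subseteq> S"
      proof clarify
        fix m assume m: "m \<in> {1..xs ! k}"
        have "xs[k := m] \<in> multi_indices d"
          using that m set_update_subset_insert[of xs k m]
          by (auto simp: S_def multi_indices_def)
        moreover have "\<pi> xs \<le> \<pi> (xs[k := m])"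
          using p that m calculation len
          by (auto simp: dim_partition_def S_def nth_list_update)
        ultimately show "xs[k := m] \<in> S" using that by (auto simp: S_def)
      qed
      have "inj_on (\<lambda>m. xs[k := m]) {1..xs ! k}"
        using that len by (intro inj_onI) (metis nth_list_update_eq)
      then have "xs ! k \<le> card S"
        using card_mono[OF fin sub] by (simp add: card_image)
      then show ?thesis using card by simp
    qed
    have inB: "set xs \<subseteq> {..volume d \<pi>} \<and> length xs = d" if "xs \<in> S"
      using that box by (auto simp: S_def multi_indices_def in_set_conv_nth)
    show "(xs \<in> {xs. set xs \<subseteq> {..volume d \<pi>} \<and> length xs = d} \<longrightarrow> \<pi> xs \<in> {..volume d \<pi>}) \<and>
          (xs \<notin> {xs. set xs \<subseteq> {..volume d \<pi>} \<and> length xs = d} \<longrightarrow> \<pi> xs = 0)"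
      using val inB off by blast
  qed
qed

text \<open>The Riemann zeta function at real arguments \<open>s > 1\<close>, where the series converges.\<close>

definition zeta :: "real \<Rightarrow> real" where
  "zeta s = (\<Sum>n. real (Suc n) powr (- s))"

end

theory Submission
  imports Defs "HOL-Real_Asymp.Real_Asymp"
begin

text \<open>
  Upper bound: taking at each index the excess of \<open>\<pi>\<close> over its largest successor encodes
  \<open>\<pi>\<close> by a finitely supported array \<open>a\<close>, and \<open>a xs\<close> counts the level sets of \<open>\<pi>\<close> having
  \<open>xs\<close> as a maximal element. In an order ideal distinct maximal elements lie on distinct lines in
  each of the \<open>d\<close> directions, so \<open>\<Sum> a xs * |xs|\<close> is at most \<open>d\<close> times the volume, where \<open>|xs|\<close>
  is the coordinate sum. Comparison with the product \<open>\<Prod> 1 / (1 - exp (- t * |xs|))\<close> yields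
  \<open>ln p\<^sub>d(n) \<le> \<zeta>(d + 1) / t ^ d + d * n * t\<close> for all \<open>t > 0\<close>.

  Lower bound: start from the staircase \<open>M - |xs|\<close> and stack on it the indicators of two nested
  subsets \<open>S \<subseteq> T\<close> of the simplex \<open>|xs| \<le> M\<close>. This is a partition as soon as \<open>T\<close> contains \<open>S\<close>
  and its immediate predecessors. The choice of \<open>T\<close> alone would give the constant \<open>ln 2\<close>; the
  sets \<open>S\<close> improve it to \<open>ln (2 + 1 / 2 ^ d)\<close>.
\<close>

section \<open>Index lists and unit steps\<close>

lemma nth_list_update_if: "xs[i := x] ! j = (if i = j \<and> i < length xs then x else xs ! j)"
  by (cases "i < length xs") (auto simp: nth_list_update list_update_beyond)

definition succ_at :: "nat \<Rightarrow> nat list \<Rightarrow> nat list" where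
  "succ_at k xs = xs[k := Suc (xs ! k)]"

definition pred_at :: "nat \<Rightarrow> nat list \<Rightarrow> nat list" where
  "pred_at k xs = xs[k := xs ! k - 1]"

definition index_box :: "nat \<Rightarrow> nat \<Rightarrow> nat list set" where
  "index_box d N = {xs. set xs \<subseteq> {1..N} \<and> length xs = d}"

lemma finite_index_box: "finite (index_box d N)"
  by (simp add: index_box_def finite_lists_length_eq)

lemma index_box_subset: "index_box d N \<subseteq> multi_indices d"
  by (auto simp: index_box_def multi_indices_def)

lemma multi_indices_nth: "xs \<in> multi_indices d \<longleftrightarrow> length xs = d \<and> (\<forall>k<d. 1 \<le> xs ! k)"
  by (auto simp: multi_indices_def all_set_conv_all_nth)

lemma index_box_nth: "xs \<in> index_box d N \<longleftrightarrow> length xs = d \<and> (\<forall>k<d. 1 \<le> xs ! k \<and> xs ! k \<le> N)"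
  by (auto simp: index_box_def subset_eq all_set_conv_all_nth)

lemma succ_at_multi_indices: "xs \<in> multi_indices d \<Longrightarrow> succ_at k xs \<in> multi_indices d"
  by (auto simp: multi_indices_nth succ_at_def nth_list_update_if)

lemma succ_pred_at: "xs \<in> multi_indices d \<Longrightarrow> k < d \<Longrightarrow> succ_at k (pred_at k xs) = xs"
  by (auto simp: multi_indices_nth succ_at_def pred_at_def)

lemma pred_succ_at: "pred_at k (succ_at k xs) = xs"
  by (cases "k < length xs") (auto simp: succ_at_def pred_at_def list_update_beyond)

lemma sum_list_succ_at: "k < length xs \<Longrightarrow> sum_list (succ_at k xs) = Suc (sum_list xs)"
  by (simp add: succ_at_def sum_list_update elem_le_sum_list)

lemma sum_list_nth_le_imp_le:
  fixes xs ys :: "nat list"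
  assumes "length xs = length ys" "\<forall>k<length ys. xs ! k \<le> ys ! k"
  shows "sum_list xs \<le> sum_list ys"
  using assms by (auto simp: sum_list_sum_nth intro!: sum_mono)

lemma dim_partition_succ_at:
  assumes "dim_partition d \<pi>" "xs \<in> multi_indices d"
  shows "\<pi> (succ_at k xs) \<le> \<pi> xs"
proof -
  have "\<forall>i<d. xs ! i \<le> succ_at k xs ! i"
    using assms(2) by (auto simp: succ_at_def nth_list_update_if multi_indices_def)
  then show ?thesis
    using assms succ_at_multi_indices[OF assms(2)] by (auto simp: dim_partition_def)
qed

text \<open>One walks from \<open>xs\<close> to \<open>ys\<close> by unit steps, each raising a
  coordinate that is still below that of \<open>ys\<close>. The gap between the coordinate sums
  shrinks, so the step inequalities give the full order condition.\<close>

lemma dim_partitionI: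
  assumes off: "\<And>xs. xs \<notin> multi_indices d \<Longrightarrow> \<pi> xs = 0"
    and fin: "finite {xs \<in> multi_indices d. \<pi> xs \<noteq> 0}"
    and step: "\<And>xs k. xs \<in> multi_indices d \<Longrightarrow> k < d \<Longrightarrow> \<pi> (succ_at k xs) \<le> \<pi> xs"
  shows "dim_partition d \<pi>"
proof -
  have "\<pi> ys \<le> \<pi> xs"
    if "xs \<in> multi_indices d" "ys \<in> multi_indices d" "\<forall>k<d. xs ! k \<le> ys ! k" for xs ys
    using that
  proof (induction "sum_list ys - sum_list xs" arbitrary: xs rule: less_induct)
    case less
    have len: "length xs = d" "length ys = d" using less.prems by (auto simp: multi_indices_def)
    show ?case
    proof (cases "xs = ys")
      case False
      then obtain k where k: "k < d" "xs ! k \<noteq> ys ! k"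
        using len by (metis nth_equalityI)
      then have lt: "xs ! k < ys ! k" using less.prems(3) by fastforce
      let ?zs = "succ_at k xs"
      have zs: "?zs \<in> multi_indices d" using less.prems(1) by (rule succ_at_multi_indices)
      have le: "\<forall>i<d. ?zs ! i \<le> ys ! i"
        using lt less.prems(3) len by (auto simp: succ_at_def nth_list_update_if)
      have "sum_list ?zs \<le> sum_list ys"
        using le len by (intro sum_list_nth_le_imp_le) (auto simp: succ_at_def)
      then have "sum_list ys - sum_list ?zs < sum_list ys - sum_list xs"
        using sum_list_succ_at[of k xs] k len by auto
      then have "\<pi> ys \<le> \<pi> ?zs" using less.hyps zs less.prems(2) le by blast
      also have "\<dots> \<le> \<pi> xs" using step less.prems(1) k by blast
      finally show ?thesis .
    qed auto
  qed
  then show ?thesis using off fin by (auto simp: dim_partition_def)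
qed

lemma volume_eq_sum:
  assumes "finite B" "B \<subseteq> multi_indices d" "\<And>xs. xs \<in> multi_indices d \<Longrightarrow> \<pi> xs \<noteq> 0 \<Longrightarrow> xs \<in> B"
  shows "volume d \<pi> = sum \<pi> B"
  unfolding volume_def using assms by (intro sum.mono_neutral_left) auto

subsection \<open>Upper bound\<close>

text \<open>
  The number of \<open>j\<close> for which \<open>xs\<close> is a maximal element of the order ideal \<open>{ys. j \<le> \<pi> ys}\<close>.
\<close>

definition corner_mult :: "nat \<Rightarrow> (nat list \<Rightarrow> nat) \<Rightarrow> nat list \<Rightarrow> nat" where
  "corner_mult d \<pi> xs = \<pi> xs - Max (insert 0 ((\<lambda>k. \<pi> (succ_at k xs)) ` {..<d}))"

lemma corner_mult_add_le:
  assumes "dim_partition d \<pi>" "xs \<in> multi_indices d" "k < d"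
  shows "corner_mult d \<pi> xs + \<pi> (succ_at k xs) \<le> \<pi> xs"
proof -
  have "\<pi> (succ_at k xs) \<le> Max (insert 0 ((\<lambda>k. \<pi> (succ_at k xs)) ` {..<d}))"
    using assms(3) by (intro Max_ge) auto
  moreover have "\<pi> (succ_at k xs) \<le> \<pi> xs" by (rule dim_partition_succ_at) fact+
  ultimately show ?thesis unfolding corner_mult_def by linarith
qed

text \<open>At a point of maximal coordinate sum where the two arrays differ, all successors agree,
  so equal excesses force equal values.\<close>

lemma corner_mult_inj:
  assumes "dim_partition d \<pi>" "dim_partition d \<rho>"
    and eq: "\<And>xs. xs \<in> B \<Longrightarrow> corner_mult d \<pi> xs = corner_mult d \<rho> xs"
    and "finite B" "\<And>xs. \<pi> xs \<noteq> 0 \<Longrightarrow> xs \<in> B" "\<And>xs. \<rho> xs \<noteq> 0 \<Longrightarrow> xs \<in> B"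
  shows "\<pi> = \<rho>"
proof (rule ccontr)
  assume "\<pi> \<noteq> \<rho>"
  define D where "D = {xs. \<pi> xs \<noteq> \<rho> xs}"
  have "D \<subseteq> B" using assms(5,6) by (auto simp: D_def) (metis gr0I)
  then have finD: "finite D" using \<open>finite B\<close> finite_subset by blast
  have "D \<noteq> {}" using \<open>\<pi> \<noteq> \<rho>\<close> by (auto simp: D_def)
  then have "Max (sum_list ` D) \<in> sum_list ` D" using finD by (intro Max_in) auto
  then obtain xs where "xs \<in> D" "Max (sum_list ` D) = sum_list xs" by blast
  then have xs: "xs \<in> D" "\<And>ys. ys \<in> D \<Longrightarrow> sum_list ys \<le> sum_list xs"
    using Max_ge[of "sum_list ` D"] finD by auto
  have mi: "xs \<in> multi_indices d"
    using xs(1) assms(1,2) by (auto simp: D_def dim_partition_def) metis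
  then have len: "length xs = d" by (simp add: multi_indices_def)
  have "\<pi> (succ_at k xs) = \<rho> (succ_at k xs)" if "k < d" for k
    using xs(2)[of "succ_at k xs"] sum_list_succ_at[of k xs] that len by (auto simp: D_def)
  then have im: "(\<lambda>k. \<pi> (succ_at k xs)) ` {..<d} = (\<lambda>k. \<rho> (succ_at k xs)) ` {..<d}"
    by (intro image_cong) auto
  \<comment> \<open>The maximum never exceeds the value, so the truncated subtraction in
    \<open>corner_mult\<close> is exact.\<close>
  have le: "Max (insert 0 ((\<lambda>k. \<sigma> (succ_at k xs)) ` {..<d})) \<le> \<sigma> xs"
    if "dim_partition d \<sigma>" for \<sigma>
    using dim_partition_succ_at[OF that mi] by (intro Max.boundedI) auto
  have "corner_mult d \<pi> xs = corner_mult d \<rho> xs" using eq xs(1) \<open>D \<subseteq> B\<close> by blast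
  then have "\<pi> xs = \<rho> xs"
    using le[OF assms(1)] le[OF assms(2)] unfolding corner_mult_def im by linarith
  then show False using xs(1) by (simp add: D_def)
qed

text \<open>
  Along a line in direction \<open>k\<close> the differences \<open>\<pi> xs - \<pi> (succ_at k xs)\<close>, weighted by
  the coordinate, add up to the volume by summation by parts.
\<close>

lemma sum_corner_mult_coord_le:
  assumes \<pi>: "dim_partition d \<pi>" and k: "k < d"
  shows "(\<Sum>xs\<in>index_box d N. corner_mult d \<pi> xs * xs ! k) \<le> sum \<pi> (index_box d N)"
proof -
  let ?B = "index_box d N"
  let ?g = "\<lambda>xs. xs ! k * \<pi> (succ_at k xs)"
  let ?C = "{xs \<in> ?B. 2 \<le> xs ! k}"
  have mi: "xs \<in> multi_indices d" if "xs \<in> ?B" for xs using that index_box_subset by blast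
  have ge1: "1 \<le> xs ! k" if "xs \<in> ?B" for xs using that k by (auto simp: index_box_nth)
  \<comment> \<open>The shifted sum \<open>sum ?g ?B\<close> is carried on the left and cancelled at
    the end instead of being subtracted.\<close>
  have "(\<Sum>xs\<in>?B. corner_mult d \<pi> xs * xs ! k) + sum ?g ?B
      = (\<Sum>xs\<in>?B. xs ! k * (corner_mult d \<pi> xs + \<pi> (succ_at k xs)))"
    by (simp add: sum.distrib algebra_simps)
  also have "\<dots> \<le> (\<Sum>xs\<in>?B. xs ! k * \<pi> xs)"
    using corner_mult_add_le[OF \<pi> mi k] by (intro sum_mono mult_left_mono) auto
  also have "\<dots> = (\<Sum>xs\<in>?B. \<pi> xs + (xs ! k - 1) * \<pi> xs)"
  proof (rule sum.cong[OF refl])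
    fix xs assume "xs \<in> ?B"
    then have "xs ! k = Suc (xs ! k - 1)" using ge1 by fastforce
    then show "xs ! k * \<pi> xs = \<pi> xs + (xs ! k - 1) * \<pi> xs" by (metis mult_Suc)
  qed
  also have "\<dots> = sum \<pi> ?B + (\<Sum>xs\<in>?B. (xs ! k - 1) * \<pi> xs)"
    by (simp add: sum.distrib)
  also have "(\<Sum>xs\<in>?B. (xs ! k - 1) * \<pi> xs) = (\<Sum>xs\<in>?C. (xs ! k - 1) * \<pi> xs)"
    by (intro sum.mono_neutral_right) (auto simp: finite_index_box)
  \<comment> \<open>One step down, the weight \<open>xs ! k - 1\<close> is the coordinate of the
    predecessor, so each term is a value of \<open>?g\<close>.\<close>
  also have "\<dots> = (\<Sum>xs\<in>?C. ?g (pred_at k xs))"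
  proof (rule sum.cong[OF refl])
    fix xs assume "xs \<in> ?C"
    then have "succ_at k (pred_at k xs) = xs" "pred_at k xs ! k = xs ! k - 1"
      using k mi succ_pred_at by (auto simp: pred_at_def index_box_def)
    then show "(xs ! k - 1) * \<pi> xs = ?g (pred_at k xs)" by simp
  qed
  also have "\<dots> = sum ?g (pred_at k ` ?C)"
  proof (rule sum.reindex_cong[symmetric, OF _ refl refl])
    show "inj_on (pred_at k) ?C"
      by (rule inj_on_inverseI[where g = "succ_at k"]) (use mi succ_pred_at k in auto)
  qed
  also have "\<dots> \<le> sum ?g ?B"
  proof (rule sum_mono2)
    show "pred_at k ` ?C \<subseteq> ?B"
    proof clarify
      fix xs assume "xs \<in> ?B" "2 \<le> xs ! k"
      then show "pred_at k xs \<in> ?B"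
        by (auto simp: index_box_nth pred_at_def nth_list_update_if diff_le_self intro: le_trans)
    qed
  qed (auto simp: finite_index_box)
  finally show ?thesis by simp
qed

lemma sum_corner_mult_le:
  assumes \<pi>: "dim_partition d \<pi>"
  shows "(\<Sum>xs\<in>index_box d N. corner_mult d \<pi> xs * sum_list xs) \<le> d * sum \<pi> (index_box d N)"
proof -
  have "(\<Sum>xs\<in>index_box d N. corner_mult d \<pi> xs * sum_list xs)
      = (\<Sum>xs\<in>index_box d N. \<Sum>k<d. corner_mult d \<pi> xs * xs ! k)"
    by (intro sum.cong)
      (auto simp: index_box_def sum_list_sum_nth sum_distrib_left atLeast0LessThan)
  also have "\<dots> = (\<Sum>k<d. \<Sum>xs\<in>index_box d N. corner_mult d \<pi> xs * xs ! k)"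
    by (rule sum.swap)
  also have "\<dots> \<le> (\<Sum>k<d. sum \<pi> (index_box d N))"
    using sum_corner_mult_coord_le[OF \<pi>] by (intro sum_mono[of "{..<d}"]) simp
  finally show ?thesis by simp
qed

section \<open>The generating product and the zeta bound\<close>

lemma sum_power_box: "(\<Sum>xs\<in>index_box d N. r ^ sum_list xs) = (\<Sum>x=1..N. r ^ x :: real) ^ d"
proof (induction d)
  case 0
  have "index_box 0 N = {[]}" by (auto simp: index_box_def)
  then show ?case by simp
next
  case (Suc d)
  have "(\<Sum>xs\<in>index_box (Suc d) N. r ^ sum_list xs)
      = (\<Sum>p\<in>index_box d N \<times> {1..N}. r ^ sum_list (fst p) * r ^ snd p)"
    unfolding index_box_def lists_length_Suc_eq
    by (subst sum.reindex) (auto simp: inj_on_def power_add mult_ac split_def)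
  also have "\<dots> = (\<Sum>xs\<in>index_box d N. \<Sum>x=1..N. r ^ sum_list xs * r ^ x)"
    by (subst sum.cartesian_product) (simp add: split_def)
  also have "\<dots> = (\<Sum>xs\<in>index_box d N. r ^ sum_list xs) * (\<Sum>x=1..N. r ^ x)"
    by (simp add: sum_product)
  finally show ?case using Suc by simp
qed

text \<open>The geometric series is at most \<open>1 / (exp s - 1)\<close>, and
  \<open>exp s - 1\<close> is at least \<open>s\<close>.\<close>

lemma sum_exp_le:
  fixes s :: real
  assumes "0 < s"
  shows "(\<Sum>x=1..N. exp (- s) ^ x) \<le> 1 / s"
proof -
  have lt: "exp (- s) < 1" using assms by simp
  have "(\<Sum>x=1..N. exp (- s) ^ x) = exp (- s) * (\<Sum>x<N. exp (- s) ^ x)"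
    by (simp add: sum_distrib_left sum.atLeast1_atMost_eq flip: power_Suc)
  also have "\<dots> = exp (- s) * (1 - exp (- s) ^ N) / (1 - exp (- s))"
    using lt by (simp add: sum_gp_strict)
  also have "\<dots> \<le> exp (- s) / (1 - exp (- s))"
    using lt by (intro divide_right_mono) (auto simp: mult_left_le)
  also have "\<dots> = 1 / (exp s - 1)"
    using lt assms by (simp add: exp_minus field_simps)
  also have "\<dots> \<le> 1 / s"
    using exp_ge_add_one_self[of s] assms
    by (intro divide_left_mono) (simp_all only: le_diff_eq add.commute, auto)
  finally show ?thesis .
qed

lemma summable_zeta: "1 < s \<Longrightarrow> summable (\<lambda>n. real (Suc n) powr (- s))"
  by (subst summable_Suc_iff) (simp add: summable_real_powr_iff)

lemma sum_list_pos_index_box: "xs \<in> index_box d N \<Longrightarrow> 1 \<le> d \<Longrightarrow> 0 < sum_list xs"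
  by (cases xs) (auto simp: index_box_def)

lemma exp_power_sum_list_less_one:
  assumes "0 < (t :: real)" "xs \<in> index_box d N" "1 \<le> d"
  shows "exp (- t) ^ sum_list xs < 1"
proof (rule power_less_one_iff[THEN iffD2, OF _ conjI])
  show "0 < sum_list xs" using assms(2,3) by (rule sum_list_pos_index_box)
qed (use assms(1) in auto)

text \<open>Expanding each logarithm and interchanging the sums leaves, for each \<open>m\<close>,
  the \<open>d\<close>-th power of a geometric sum, which is at most \<open>1 / (m * t) ^ d\<close>.
  The factor \<open>1 / m\<close> of the logarithm series raises the exponent to
  \<open>d + 1\<close>. The bound is uniform in \<open>N\<close>.\<close>

lemma sum_ln_le_zeta:
  assumes d: "1 \<le> d" and t: "0 < t"
  shows "(\<Sum>xs\<in>index_box d N. - ln (1 - exp (- t) ^ sum_list xs)) \<le> zeta (real d + 1) / t ^ d"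
proof -
  let ?q = "exp (- t)"
  let ?f = "\<lambda>xs m. (?q ^ sum_list xs) ^ m / real m"
  have sums: "?f xs sums (- ln (1 - ?q ^ sum_list xs))" if "xs \<in> index_box d N" for xs
  proof -
    have "?q ^ sum_list xs < 1" using t that d by (rule exp_power_sum_list_less_one)
    then have "\<bar>- (?q ^ sum_list xs)\<bar> < 1" by simp
    from sums_minus[OF ln_series'[OF this]] show ?thesis by simp
  qed
  have "(\<lambda>m. \<Sum>xs\<in>index_box d N. ?f xs m) sums (\<Sum>xs\<in>index_box d N. - ln (1 - ?q ^ sum_list xs))"
    by (intro sums_sum sums)
  \<comment> \<open>The term at index \<open>0\<close> is a division by zero, hence
    \<open>0\<close>, so the series may start at \<open>1\<close>.\<close>
  then have L: "(\<lambda>m. \<Sum>xs\<in>index_box d N. ?f xs (Suc m)) sums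
      (\<Sum>xs\<in>index_box d N. - ln (1 - ?q ^ sum_list xs))"
    by (subst sums_Suc_iff) simp
  have R: "(\<lambda>m. real (Suc m) powr (- (real d + 1)) / t ^ d) sums (zeta (real d + 1) / t ^ d)"
    unfolding zeta_def using d by (intro sums_divide summable_sums summable_zeta) auto
  show ?thesis
  proof (rule sums_le[OF _ L R])
    fix m
    let ?m = "real (Suc m)"
    have "(\<Sum>xs\<in>index_box d N. ?f xs (Suc m)) = (\<Sum>xs\<in>index_box d N. (?q ^ Suc m) ^ sum_list xs) / ?m"
      by (simp only: sum_divide_distrib power_mult[symmetric] mult.commute)
    also have "\<dots> = (\<Sum>x=1..N. (?q ^ Suc m) ^ x) ^ d / ?m"
      by (simp only: sum_power_box)
    also have "?q ^ Suc m = exp (- (?m * t))"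
      by (simp only: exp_of_nat_mult[symmetric] mult_minus_right)
    also have "(\<Sum>x=1..N. exp (- (?m * t)) ^ x) ^ d / ?m \<le> (1 / (?m * t)) ^ d / ?m"
      using t by (intro divide_right_mono power_mono sum_exp_le sum_nonneg) auto
    also have "\<dots> = 1 / ?m ^ Suc d / t ^ d"
      by (simp add: power_mult_distrib field_simps del: of_nat_Suc)
    also have "?m ^ Suc d = ?m powr (real d + 1)"
      using powr_realpow[of ?m "Suc d"] by (simp add: add.commute)
    also have "1 / ?m powr (real d + 1) = ?m powr (- (real d + 1))"
      by (simp only: powr_minus_divide)
    finally show "(\<Sum>xs\<in>index_box d N. ?f xs (Suc m)) \<le> ?m powr (- (real d + 1)) / t ^ d" .
  qed
qed

text \<open>Each code \<open>f\<close> gets the weight \<open>?w f\<close>. Partitions of volume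
  \<open>n\<close> have distinct codes of weight at least \<open>?q ^ (d * n)\<close>, while all
  codes with entries up to \<open>n\<close> together weigh at most the product of the geometric
  series.\<close>

lemma num_partitions_le_exp:
  assumes d: "1 \<le> d" and t: "0 < t"
  shows "real (num_partitions d n) \<le> exp (zeta (real d + 1) / t ^ d + real d * real n * t)"
proof -
  define P where "P = {\<pi>. dim_partition d \<pi> \<and> volume d \<pi> = n}"
  have finP: "finite P" unfolding P_def by (rule finite_partitions_of_volume)
  define U where "U = (\<Union>\<pi>\<in>P. {xs \<in> multi_indices d. \<pi> xs \<noteq> 0})"
  have finU: "finite U"
    unfolding U_def using finP by (auto simp: P_def dim_partition_def)
  \<comment> \<open>Only finitely many partitions have volume \<open>n\<close>, so one box holds all
    their supports; the inserted \<open>0\<close> covers an empty union.\<close>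
  define N where "N = Max (insert 0 (\<Union>xs\<in>U. set xs))"
  let ?B = "index_box d N"
  have supp: "xs \<in> ?B" if "\<pi> \<in> P" "\<pi> xs \<noteq> 0" for \<pi> xs
  proof -
    have mi: "xs \<in> multi_indices d" using that by (auto simp: P_def dim_partition_def)
    then have "xs \<in> U" using that by (auto simp: U_def)
    then have "x \<le> N" if "x \<in> set xs" for x
      unfolding N_def using that finU by (intro Max_ge) auto
    then show ?thesis using mi by (auto simp: index_box_def multi_indices_def)
  qed
  have vol: "sum \<pi> ?B = n" if "\<pi> \<in> P" for \<pi>
  proof -
    have "volume d \<pi> = sum \<pi> ?B"
      using supp[OF that] finite_index_box index_box_subset by (intro volume_eq_sum) auto
    then show ?thesis using that by (simp add: P_def)
  qed
  let ?q = "exp (- t)"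
  have q: "0 < ?q" "?q < 1" using t by auto
  \<comment> \<open>Restriction places the codes in the \<open>PiE\<close> over which sum and
    product are exchanged below.\<close>
  let ?\<Phi> = "\<lambda>\<pi>. restrict (corner_mult d \<pi>) ?B"
  let ?w = "\<lambda>f. \<Prod>xs\<in>?B. (?q ^ sum_list xs) ^ f xs"
  have ub: "(\<Sum>m\<le>n. (?q ^ sum_list xs) ^ m) \<le> inverse (1 - ?q ^ sum_list xs)"
    if "xs \<in> ?B" for xs
  proof -
    have lt: "?q ^ sum_list xs < 1" using t that d by (rule exp_power_sum_list_less_one)
    have "(\<Sum>m\<le>n. (?q ^ sum_list xs) ^ m) = (1 - (?q ^ sum_list xs) ^ Suc n) / (1 - ?q ^ sum_list xs)"
      using lt by (simp only: lessThan_Suc_atMost[symmetric] sum_gp_strict) auto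
    also have "\<dots> \<le> 1 / (1 - ?q ^ sum_list xs)"
      using lt by (intro divide_right_mono) auto
    finally show ?thesis by (simp add: inverse_eq_divide)
  qed
  have w: "exp (real d * real n * t) * ?w (?\<Phi> \<pi>) \<ge> 1" if "\<pi> \<in> P" for \<pi>
  proof -
    have "?w (?\<Phi> \<pi>) = ?q ^ (\<Sum>xs\<in>?B. corner_mult d \<pi> xs * sum_list xs)"
      by (simp add: power_sum power_mult[symmetric] mult.commute)
    also have "\<dots> \<ge> ?q ^ (d * n)"
      using sum_corner_mult_le[of d \<pi> N] vol[OF that] that q
      by (intro power_decreasing) (auto simp: P_def)
    also have "?q ^ (d * n) = exp (- (real d * real n * t))"
      by (simp flip: exp_of_nat_mult)
    finally show ?thesis by (simp add: exp_minus field_simps)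
  qed
  have inj: "inj_on ?\<Phi> P"
  proof (rule inj_onI)
    fix \<pi> \<rho> assume "\<pi> \<in> P" "\<rho> \<in> P" and eq: "?\<Phi> \<pi> = ?\<Phi> \<rho>"
    have "corner_mult d \<pi> xs = corner_mult d \<rho> xs" if "xs \<in> ?B" for xs
      using fun_cong[OF eq, of xs] that by simp
    then show "\<pi> = \<rho>"
      using \<open>\<pi> \<in> P\<close> \<open>\<rho> \<in> P\<close> supp finite_index_box
      by (intro corner_mult_inj[of d \<pi> \<rho> ?B]) (auto simp: P_def)
  qed
  have img: "?\<Phi> ` P \<subseteq> PiE ?B (\<lambda>_. {..n})"
  proof clarify
    fix \<pi> assume \<pi>: "\<pi> \<in> P"
    have "corner_mult d \<pi> xs \<le> n" if "xs \<in> ?B" for xs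
    proof -
      have "corner_mult d \<pi> xs \<le> \<pi> xs" by (simp add: corner_mult_def)
      also have "\<dots> \<le> sum \<pi> ?B" using that finite_index_box by (intro member_le_sum) auto
      finally show ?thesis using vol[OF \<pi>] by simp
    qed
    then show "?\<Phi> \<pi> \<in> PiE ?B (\<lambda>_. {..n})" by auto
  qed
  have "real (num_partitions d n) = (\<Sum>\<pi>\<in>P. 1)"
    by (simp add: num_partitions_def P_def)
  also have "\<dots> \<le> (\<Sum>\<pi>\<in>P. exp (real d * real n * t) * ?w (?\<Phi> \<pi>))"
    using w by (rule sum_mono)
  also have "\<dots> = exp (real d * real n * t) * (\<Sum>f\<in>?\<Phi> ` P. ?w f)"
    using inj by (subst sum.reindex) (simp_all add: sum_distrib_left)
  also have "\<dots> \<le> exp (real d * real n * t) * (\<Sum>f\<in>PiE ?B (\<lambda>_. {..n}). ?w f)"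
    using img q finite_index_box
    by (intro mult_left_mono sum_mono2 finite_PiE prod_nonneg) auto
  also have "(\<Sum>f\<in>PiE ?B (\<lambda>_. {..n}). ?w f) = (\<Prod>xs\<in>?B. \<Sum>m\<le>n. (?q ^ sum_list xs) ^ m)"
    using finite_index_box by (intro prod_sum_PiE[symmetric]) auto
  also have "\<dots> \<le> (\<Prod>xs\<in>?B. inverse (1 - ?q ^ sum_list xs))"
    using ub q by (intro prod_mono) (auto intro!: sum_nonneg)
  also have "\<dots> = (\<Prod>xs\<in>?B. exp (- ln (1 - ?q ^ sum_list xs)))"
  proof (rule prod.cong[OF refl])
    fix xs assume "xs \<in> ?B"
    then have "?q ^ sum_list xs < 1" using t d by (intro exp_power_sum_list_less_one)
    then show "inverse (1 - ?q ^ sum_list xs) = exp (- ln (1 - ?q ^ sum_list xs))"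
      by (simp add: exp_minus)
  qed
  also have "\<dots> = exp (\<Sum>xs\<in>?B. - ln (1 - ?q ^ sum_list xs))"
    using finite_index_box by (simp add: exp_sum)
  also have "\<dots> \<le> exp (zeta (real d + 1) / t ^ d)"
    using sum_ln_le_zeta[OF d t] by simp
  finally show ?thesis by (simp add: exp_add mult.commute)
qed

lemma zeta_pos:
  assumes "1 < s"
  shows "0 < zeta s"
  unfolding zeta_def using summable_zeta[OF assms] by (intro suminf_pos) auto

text \<open>At the optimal \<open>t\<close>, both \<open>?z / t ^ d\<close> and \<open>n * t\<close>
  equal \<open>?z powr ?e * n powr (d / (d + 1))\<close>, where \<open>?z\<close> is the zeta value.
  The first enters once and the second \<open>d\<close> times, whence the factor
  \<open>d + 1\<close>.\<close>

lemma ln_num_partitions_le: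
  assumes d: "1 \<le> d" and n: "0 < n" and pos: "0 < num_partitions d n"
  shows "ln (real (num_partitions d n))
    \<le> (real d + 1) * zeta (real d + 1) powr (1 / (real d + 1)) * real n powr (real d / (real d + 1))"
proof -
  let ?z = "zeta (real d + 1)" and ?e = "1 / (real d + 1)"
  have z: "0 < ?z" using zeta_pos[of "real d + 1"] d by simp
  text \<open>The minimiser of \<open>t \<mapsto> ?z / t ^ d + d * n * t\<close>.\<close>
  define t where "t = (?z / real n) powr ?e"
  have t: "0 < t" using z n by (simp add: t_def)
  have "?e * real d = real d / (real d + 1)" by simp
  then have td: "t ^ d = ?z powr (real d / (real d + 1)) / real n powr (real d / (real d + 1))"
    using z n t by (simp add: t_def powr_powr powr_divide flip: powr_realpow)
  have split: "x = x powr ?e * x powr (real d / (real d + 1))" if "0 < x" for x :: real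
  proof -
    have "?e + real d / (real d + 1) = 1" by (simp add: field_simps)
    then show ?thesis using that by (metis powr_add powr_one less_imp_le)
  qed
  have "?z / t ^ d = ?z powr ?e * real n powr (real d / (real d + 1))"
    unfolding td using z n by (subst (1) split[OF z]) (simp add: field_simps)
  moreover have "real n * t = ?z powr ?e * real n powr (real d / (real d + 1))"
    unfolding t_def powr_divide
    using n by (subst (1) split[of "real n"]) (simp_all add: field_simps)
  moreover have "ln (real (num_partitions d n)) \<le> ?z / t ^ d + real d * (real n * t)"
    using num_partitions_le_exp[OF d t, of n] pos
    by (metis ln_le_cancel_iff ln_exp exp_gt_zero of_nat_0_less_iff mult.assoc)
  ultimately show ?thesis by (simp add: algebra_simps)
qed

subsection \<open>Lower bound\<close>

text \<open>This lets a construction aim at volume at most \<open>n\<close>. The missing volume is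
  added to the entry at the corner \<open>c\<close>; the padded array and the missing amount, one of
  \<open>n + 1\<close> values, determine the original.\<close>

lemma card_partitions_le:
  assumes "finite F" and F: "\<And>\<pi>. \<pi> \<in> F \<Longrightarrow> dim_partition d \<pi> \<and> volume d \<pi> \<le> n"
  shows "card F \<le> (n + 1) * num_partitions d n"
proof -
  define c where "c = replicate d (1::nat)"
  define P where "P = {\<pi>. dim_partition d \<pi> \<and> volume d \<pi> = n}"
  define pad where "pad = (\<lambda>\<pi>. \<pi>(c := \<pi> c + (n - volume d \<pi>)))"
  have c: "c \<in> multi_indices d" by (auto simp: c_def multi_indices_def)
  have "pad \<pi> \<in> P" if "\<pi> \<in> F" for \<pi>
  proof -
    have \<pi>: "dim_partition d \<pi>" "volume d \<pi> \<le> n" using F that by auto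
    let ?B = "insert c {xs \<in> multi_indices d. \<pi> xs \<noteq> 0}"
    have fin: "finite ?B" using \<pi>(1) by (simp add: dim_partition_def)
    have "dim_partition d (pad \<pi>)"
    proof (rule dim_partitionI)
      fix xs assume "xs \<notin> multi_indices d"
      then show "pad \<pi> xs = 0" using \<pi>(1) c by (auto simp: pad_def dim_partition_def)
    next
      show "finite {xs \<in> multi_indices d. pad \<pi> xs \<noteq> 0}"
        by (rule finite_subset[OF _ fin]) (auto simp: pad_def)
    next
      fix xs k assume xs: "xs \<in> multi_indices d" and k: "k < d"
      have "succ_at k xs ! k = Suc (xs ! k)" "1 \<le> xs ! k"
        using xs k by (auto simp: succ_at_def multi_indices_nth)
      \<comment> \<open>The corner is never the upper end of a unit step, so raising its entry
        preserves every step inequality.\<close>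
      then have "succ_at k xs \<noteq> c" using k by (auto simp: c_def)
      then show "pad \<pi> (succ_at k xs) \<le> pad \<pi> xs"
        using dim_partition_succ_at[OF \<pi>(1) xs, of k] by (auto simp: pad_def)
    qed
    moreover have "volume d (pad \<pi>) = n"
    proof -
      have "volume d (pad \<pi>) = sum (pad \<pi>) ?B"
        using fin c by (intro volume_eq_sum) (auto simp: pad_def split: if_splits)
      also have "\<dots> = sum (\<lambda>xs. \<pi> xs + (if xs = c then n - volume d \<pi> else 0)) ?B"
        by (intro sum.cong) (auto simp: pad_def)
      also have "\<dots> = sum \<pi> ?B + (n - volume d \<pi>)"
        using fin by (simp only: sum.distrib sum.delta') simp
      also have "sum \<pi> ?B = volume d \<pi>"
        using fin c by (intro volume_eq_sum[symmetric]) auto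
      finally show ?thesis using \<pi>(2) by simp
    qed
    ultimately show ?thesis by (simp add: P_def)
  qed
  then have "(\<lambda>\<pi>. (pad \<pi>, n - volume d \<pi>)) ` F \<subseteq> P \<times> {..n}" by auto
  moreover have "inj_on (\<lambda>\<pi>. (pad \<pi>, n - volume d \<pi>)) F"
  proof (rule inj_onI)
    fix \<pi> \<rho> assume eq: "(pad \<pi>, n - volume d \<pi>) = (pad \<rho>, n - volume d \<rho>)"
    show "\<pi> = \<rho>"
    proof
      fix xs
      have "pad \<pi> xs = pad \<rho> xs" "n - volume d \<pi> = n - volume d \<rho>" using eq by auto
      then show "\<pi> xs = \<rho> xs" by (auto simp: pad_def split: if_splits)
    qed
  qed
  moreover have "finite (P \<times> {..n})"
    unfolding P_def using finite_partitions_of_volume by auto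
  ultimately have "card F \<le> card (P \<times> {..n})" by (metis card_inj_on_le)
  then show ?thesis by (simp add: card_cartesian_product num_partitions_def P_def mult.commute)
qed

section \<open>Staircases over a simplex with two extra layers\<close>

definition corner_simplex :: "nat \<Rightarrow> nat \<Rightarrow> nat list set" where
  "corner_simplex d M = {xs \<in> multi_indices d. sum_list xs \<le> M}"

lemma finite_corner_simplex: "finite (corner_simplex d M)"
proof (rule finite_subset[OF _ finite_index_box])
  show "corner_simplex d M \<subseteq> index_box d M"
    using member_le_sum_list order_trans
    by (fastforce simp: corner_simplex_def multi_indices_def index_box_def)
qed

text \<open>Splitting off the first coordinate \<open>x\<close> leaves a simplex of size
  \<open>M - x\<close>; the sum of binomials collapses by the hockey-stick identity.\<close>

lemma card_corner_simplex: "card (corner_simplex d M) = M choose d"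
proof (induction d arbitrary: M)
  case 0
  have "corner_simplex 0 M = {[]}" by (auto simp: corner_simplex_def multi_indices_def)
  then show ?case by simp
next
  case (Suc d)
  have "corner_simplex (Suc d) M = (\<lambda>(x, xs). x # xs) ` (SIGMA x:{1..M}. corner_simplex d (M - x))"
    by (auto simp: corner_simplex_def multi_indices_def length_Suc_conv image_iff)
  then have "card (corner_simplex (Suc d) M) = card (SIGMA x:{1..M}. corner_simplex d (M - x))"
    by (simp add: card_image inj_on_def split_def prod_eq_iff)
  also have "\<dots> = (\<Sum>x=1..M. (M - x) choose d)"
    using Suc by (subst card_SigmaI) (auto simp: finite_corner_simplex)
  also have "\<dots> = (\<Sum>x<M. x choose d)"
    using sum.nat_diff_reindex[of "\<lambda>x. x choose d" M]
    by (simp add: sum.atLeast1_atMost_eq)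
  also have "\<dots> = M choose Suc d"
    using sum_choose_upper[of d "M - 1"] by (cases M) (auto simp: lessThan_Suc_atMost)
  finally show ?case .
qed

text \<open>The cells under the staircase form the simplex one dimension higher, the new first
  coordinate being the height.\<close>

lemma sum_height_corner_simplex: "(\<Sum>xs\<in>corner_simplex d M. M - sum_list xs) = M choose Suc d"
proof -
  have "corner_simplex (Suc d) M = (\<lambda>(xs, x). x # xs) ` (SIGMA xs:corner_simplex d M. {1..M - sum_list xs})"
    by (auto simp: corner_simplex_def multi_indices_def length_Suc_conv image_iff)
  then have "card (corner_simplex (Suc d) M) = card (SIGMA xs:corner_simplex d M. {1..M - sum_list xs})"
    by (simp add: card_image inj_on_def split_def prod_eq_iff)
  also have "\<dots> = (\<Sum>xs\<in>corner_simplex d M. M - sum_list xs)"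
    by (subst card_SigmaI) (auto simp: finite_corner_simplex)
  finally show ?thesis by (simp add: card_corner_simplex)
qed

text \<open>The guard \<open>2 \<le> xs ! k\<close> drops predecessors that would leave the index
  set through a coordinate \<open>0\<close>.\<close>

definition closed_nbhd :: "nat \<Rightarrow> nat list set \<Rightarrow> nat list set" where
  "closed_nbhd d S = S \<union> (\<Union>k<d. pred_at k ` {xs \<in> S. 2 \<le> xs ! k})"

lemma card_closed_nbhd_le:
  assumes "finite S"
  shows "card (closed_nbhd d S) \<le> (d + 1) * card S"
proof -
  have "card (closed_nbhd d S) \<le> card S + card (\<Union>k<d. pred_at k ` {xs \<in> S. 2 \<le> xs ! k})"
    unfolding closed_nbhd_def by (rule card_Un_le)
  also have "card (\<Union>k<d. pred_at k ` {xs \<in> S. 2 \<le> xs ! k})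
      \<le> (\<Sum>k<d. card (pred_at k ` {xs \<in> S. 2 \<le> xs ! k}))"
    by (rule card_UN_le) simp
  also have "\<dots> \<le> (\<Sum>k<d. card S)"
  proof (rule sum_mono)
    fix k
    have "card (pred_at k ` {xs \<in> S. 2 \<le> xs ! k}) \<le> card {xs \<in> S. 2 \<le> xs ! k}"
      using assms by (intro card_image_le) auto
    also have "\<dots> \<le> card S" using assms by (intro card_mono) auto
    finally show "card (pred_at k ` {xs \<in> S. 2 \<le> xs ! k}) \<le> card S" .
  qed
  finally show ?thesis by simp
qed

lemma closed_nbhd_subset:
  assumes "S \<subseteq> corner_simplex d M"
  shows "closed_nbhd d S \<subseteq> corner_simplex d M"
proof -
  have "pred_at k xs \<in> corner_simplex d M" if "xs \<in> corner_simplex d M" "k < d" "2 \<le> xs ! k" for k xs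
  proof -
    have mi: "xs \<in> multi_indices d" using that by (simp add: corner_simplex_def)
    then have len: "length xs = d" by (simp add: multi_indices_def)
    have "pred_at k xs \<in> multi_indices d"
      using mi that by (auto simp: multi_indices_nth pred_at_def nth_list_update_if)
    moreover have "sum_list (pred_at k xs) \<le> sum_list xs"
      using len by (intro sum_list_nth_le_imp_le) (auto simp: pred_at_def nth_list_update_if)
    ultimately show ?thesis using that(1) by (auto simp: corner_simplex_def)
  qed
  then show ?thesis using assms by (fastforce simp: closed_nbhd_def)
qed

definition layered :: "nat \<Rightarrow> nat \<Rightarrow> nat list set \<Rightarrow> nat list set \<Rightarrow> nat list \<Rightarrow> nat" where
  "layered d M S T xs =
    (if xs \<in> corner_simplex d M then (M - sum_list xs) + of_bool (xs \<in> T) + of_bool (xs \<in> S) else 0)"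

text \<open>Inside the simplex the staircase falls by one at each unit step, which makes up for a
  rise of one in the layers. A rise of two needs a point of \<open>S\<close> right after a point
  outside \<open>T\<close>, and the hypothesis excludes that.\<close>

lemma dim_partition_layered:
  assumes "closed_nbhd d S \<subseteq> T"
  shows "dim_partition d (layered d M S T)"
proof (rule dim_partitionI)
  fix xs k assume xs: "xs \<in> multi_indices d" and k: "k < d"
  let ?ys = "succ_at k xs"
  have len: "length xs = d" using xs by (simp add: multi_indices_def)
  show "layered d M S T ?ys \<le> layered d M S T xs"
  proof (cases "?ys \<in> corner_simplex d M")
    case True
    have sum: "sum_list ?ys = Suc (sum_list xs)" using k len by (intro sum_list_succ_at) auto
    with True have le: "Suc (sum_list xs) \<le> M" by (simp add: corner_simplex_def)
    then have xsI: "xs \<in> corner_simplex d M" using xs by (simp add: corner_simplex_def)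
    have "xs \<in> T" if "?ys \<in> S"
    proof -
      have "2 \<le> ?ys ! k" using xs k by (auto simp: succ_at_def multi_indices_nth)
      then have "pred_at k ?ys \<in> closed_nbhd d S" using that k by (auto simp: closed_nbhd_def)
      then show ?thesis using assms by (auto simp: pred_succ_at)
    qed
    then show ?thesis using True xsI sum le by (auto simp: layered_def)
  qed (simp add: layered_def)
next
  show "finite {xs \<in> multi_indices d. layered d M S T xs \<noteq> 0}"
    by (rule finite_subset[OF _ finite_corner_simplex[of d M]])
      (auto simp: layered_def split: if_splits)
qed (simp add: layered_def corner_simplex_def)

lemma volume_layered_le: "volume d (layered d M S T) \<le> (M + 2) choose (d + 1)"
proof -
  have "volume d (layered d M S T) = sum (layered d M S T) (corner_simplex d M)"
    by (intro volume_eq_sum finite_corner_simplex)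
      (auto simp: layered_def corner_simplex_def split: if_splits)
  also have "\<dots> \<le> (\<Sum>xs\<in>corner_simplex d M. (M - sum_list xs) + 2)"
    by (intro sum_mono) (auto simp: layered_def)
  also have "\<dots> = (M choose Suc d) + 2 * (M choose d)"
    by (simp only: sum.distrib sum_height_corner_simplex) (simp add: card_corner_simplex)
  \<comment> \<open>Enlarging one of the two copies of \<open>M choose d\<close> lets Pascal's rule
    apply twice.\<close>
  also have "\<dots> \<le> (M choose Suc d) + (M choose d) + (Suc M choose d)"
    using binomial_right_mono[of M "Suc M" d] by simp
  also have "\<dots> = (M + 2) choose (d + 1)" by simp
  finally show ?thesis .
qed

text \<open>As \<open>S \<subseteq> T\<close>, the excess over the staircase is positive exactly on
  \<open>T\<close> and equal to \<open>2\<close> exactly on \<open>S\<close>.\<close>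

lemma inj_on_layered:
  "inj_on (\<lambda>(S, T). layered d M S T)
    (SIGMA S:Pow (corner_simplex d M). {T. closed_nbhd d S \<subseteq> T \<and> T \<subseteq> corner_simplex d M})"
proof (rule inj_onI, clarify)
  fix S T S' T'
  assume sub: "S \<subseteq> corner_simplex d M" "T \<subseteq> corner_simplex d M" "S' \<subseteq> corner_simplex d M" "T' \<subseteq> corner_simplex d M"
    and nb: "closed_nbhd d S \<subseteq> T" "closed_nbhd d S' \<subseteq> T'"
    and eq: "layered d M S T = layered d M S' T'"
  have ST: "S \<subseteq> T" "S' \<subseteq> T'" using nb by (auto simp: closed_nbhd_def)
  have "(xs \<in> S \<longleftrightarrow> xs \<in> S') \<and> (xs \<in> T \<longleftrightarrow> xs \<in> T')" if "xs \<in> corner_simplex d M" for xs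
    using fun_cong[OF eq, of xs] that ST by (auto simp: layered_def of_bool_def split: if_splits)
  then show "S = S' \<and> T = T'" using sub by blast
qed

section \<open>Counting the nested pairs\<close>

lemma card_interval_sets:
  assumes "finite I" "A \<subseteq> I"
  shows "card {T. A \<subseteq> T \<and> T \<subseteq> I} = 2 ^ (card I - card A)"
proof -
  have "bij_betw (\<lambda>T. T - A) {T. A \<subseteq> T \<and> T \<subseteq> I} (Pow (I - A))"
    by (rule bij_betwI[where g = "\<lambda>U. U \<union> A"]) (use assms in auto)
  then have "card {T. A \<subseteq> T \<and> T \<subseteq> I} = card (Pow (I - A))" by (rule bij_betw_same_card)
  then show ?thesis
    using assms by (simp add: card_Pow card_Diff_subset finite_subset)
qed

lemma sum_power_card_Pow:
  fixes y :: "'a :: comm_semiring_1"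
  assumes "finite I"
  shows "(\<Sum>S\<in>Pow I. y ^ card S) = (1 + y) ^ card I"
  using prod_add[OF assms, of "\<lambda>_. y" "\<lambda>_. 1"] by (simp add: add.commute)

text \<open>
  A point of \<open>S\<close> costs at most the \<open>d + 1\<close> free choices in its closed neighbourhood, so
  summing \<open>2 ^ (card I - card (closed_nbhd d S))\<close> over all \<open>S\<close> gives a binomial expansion.
\<close>

lemma power_card_corner_simplex_le:
  assumes "(M + 2) choose (d + 1) \<le> n"
  shows "(2 + 1 / 2 ^ d) ^ (M choose d) \<le> (real n + 1) * real (num_partitions d n)"
proof -
  let ?I = "corner_simplex d M"
  let ?A = "SIGMA S:Pow ?I. {T. closed_nbhd d S \<subseteq> T \<and> T \<subseteq> ?I}"
  let ?F = "(\<lambda>(S, T). layered d M S T) ` ?A"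
  let ?y = "1 / 2 ^ (d + 1) :: real"
  have fin: "finite ?I" by (rule finite_corner_simplex)
  have finT: "finite {T. closed_nbhd d S \<subseteq> T \<and> T \<subseteq> ?I}" for S
    by (rule finite_subset[of _ "Pow ?I"]) (use fin in auto)
  \<comment> \<open>The factor \<open>2\<close> is the free choice for \<open>T\<close> at a point,
    and \<open>?y\<close> is the price of putting a point into \<open>S\<close>.\<close>
  have "(2 + 1 / 2 ^ d) ^ (M choose d) = (2 * (1 + ?y)) ^ card ?I"
    by (simp add: card_corner_simplex distrib_left)
  also have "\<dots> = (\<Sum>S\<in>Pow ?I. 2 ^ card ?I * ?y ^ card S)"
    using fin by (simp only: power_mult_distrib sum_power_card_Pow[symmetric] sum_distrib_left)
  also have "\<dots> \<le> (\<Sum>S\<in>Pow ?I. real (card {T. closed_nbhd d S \<subseteq> T \<and> T \<subseteq> ?I}))"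
  proof (rule sum_mono)
    fix S assume "S \<in> Pow ?I"
    then have S: "S \<subseteq> ?I" by simp
    let ?c = "card (closed_nbhd d S)"
    have c: "?c \<le> card ?I" using closed_nbhd_subset[OF S] fin by (rule card_mono[rotated])
    have "?c \<le> (d + 1) * card S" using S fin by (intro card_closed_nbhd_le) (rule finite_subset)
    then have "(2::real) ^ ?c \<le> 2 ^ ((d + 1) * card S)" by (rule power_increasing) simp
    then have "2 ^ card ?I / 2 ^ ((d + 1) * card S) \<le> 2 ^ card ?I / (2 ^ ?c :: real)"
      by (intro divide_left_mono) auto
    also have "\<dots> = 2 ^ (card ?I - ?c)" using c by (simp add: power_diff)
    also have "\<dots> = real (card {T. closed_nbhd d S \<subseteq> T \<and> T \<subseteq> ?I})"
      using card_interval_sets[OF fin closed_nbhd_subset[OF S]] by simp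
    finally show "2 ^ card ?I * ?y ^ card S \<le> real (card {T. closed_nbhd d S \<subseteq> T \<and> T \<subseteq> ?I})"
      by (simp only: power_divide power_one power_mult[symmetric] times_divide_eq_right mult_1_right)
  qed
  also have "\<dots> = real (card ?A)"
    using fin finT by (subst card_SigmaI) auto
  also have "\<dots> = real (card ?F)"
    using inj_on_layered by (simp only: card_image)
  also have "\<dots> \<le> real ((n + 1) * num_partitions d n)"
  proof (intro of_nat_mono card_partitions_le)
    show "finite ?F" using fin finT by (intro finite_imageI finite_SigmaI) auto
    show "dim_partition d \<pi> \<and> volume d \<pi> \<le> n" if "\<pi> \<in> ?F" for \<pi>
      using that dim_partition_layered order_trans[OF volume_layered_le assms] by auto
  qed
  finally show ?thesis by (simp add: algebra_simps)
qed

section \<open>Asymptotics of the lower bound\<close>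

text \<open>The right side is a falling factorial with \<open>d\<close> factors, each at least
  \<open>M - d\<close>; for \<open>M < d\<close> the left side is \<open>0\<close>.\<close>

lemma power_le_binomial_mult_fact: "(M - d) ^ d \<le> (M choose d) * fact d"
proof (induction d)
  case (Suc d)
  have "(M - Suc d) ^ Suc d \<le> (M - d) * (M - d) ^ d"
    by (simp add: mult_mono power_mono)
  also have "\<dots> \<le> (M - d) * ((M choose d) * fact d)" using Suc by (rule mult_left_mono) simp
  also have "\<dots> = ((M - d) * (M choose d)) * fact d" by simp
  also have "(M - d) * (M choose d) = Suc d * (M choose Suc d)"
    by (metis binomial_absorb_comp binomial_absorption mult.commute)
  finally show ?case by (simp only: fact_Suc of_nat_id mult_ac)
qed auto

text \<open>The scale \<open>x n\<close> solves \<open>x ^ (d + 1) / fact (d + 1) = n\<close>, the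
  approximate volume of a staircase of size \<open>x\<close>. After division by
  \<open>x n ^ d\<close> the shift by \<open>d + 3\<close> and the logarithm disappear in the limit,
  and the gap \<open>\<delta> < L\<close> absorbs them.\<close>

lemma eventually_lower_bound:
  fixes \<delta> L :: real
  assumes d: "1 \<le> d" and \<delta>: "\<delta> < L"
  defines "x \<equiv> \<lambda>n. (fact (d + 1) * real n) powr (1 / (real d + 1))"
  shows "\<forall>\<^sub>F n in sequentially.
    \<delta> * x n ^ d + fact d * ln (real n + 1) \<le> L * (x n - real d - 3) ^ d"
proof -
  define e where "e = 1 / (real d + 1)"
  have e: "0 < e" by (simp add: e_def)
  have x_lim: "filterlim x at_top sequentially"
    unfolding x_def e_def[symmetric] using e by real_asymp
  have "((\<lambda>u. (u - real d - 3) / u) \<longlongrightarrow> 1) at_top" by real_asymp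
  from filterlim_compose[OF this x_lim]
  have l1: "(\<lambda>n. (x n - real d - 3) / x n) \<longlonglongrightarrow> 1" .
  have l2: "(\<lambda>n. ln (real n + 1) / x n) \<longlonglongrightarrow> 0"
    unfolding x_def e_def[symmetric] using e by real_asymp
  have "(\<lambda>n. L * ((x n - real d - 3) / x n) ^ d - fact d * (ln (real n + 1) / x n))
      \<longlonglongrightarrow> L * 1 ^ d - fact d * 0"
    by (intro tendsto_intros l1 l2)
  then have "\<forall>\<^sub>F n in sequentially.
      \<delta> < L * ((x n - real d - 3) / x n) ^ d - fact d * (ln (real n + 1) / x n)"
    using \<delta> by (intro order_tendstoD(1)) auto
  moreover have "\<forall>\<^sub>F n in sequentially. 1 \<le> x n"
    using x_lim by (simp add: filterlim_at_top)
  ultimately show ?thesis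
  proof eventually_elim
    case (elim n)
    \<comment> \<open>Dividing the logarithm by the full power only shrinks it, so the limit with a
      single \<open>x n\<close> below suffices.\<close>
    have "x n \<le> x n ^ d" using elim(2) d by (intro self_le_power) auto
    then have "fact d * (ln (real n + 1) / x n ^ d) \<le> fact d * (ln (real n + 1) / x n)"
      using elim(2) by (intro mult_left_mono divide_left_mono) auto
    then have "\<delta> \<le> L * ((x n - real d - 3) / x n) ^ d - fact d * (ln (real n + 1) / x n ^ d)"
      using elim(1) by linarith
    then have "\<delta> * x n ^ d
        \<le> (L * ((x n - real d - 3) / x n) ^ d - fact d * (ln (real n + 1) / x n ^ d)) * x n ^ d"
      using elim(2) by (intro mult_right_mono) auto
    also have "\<dots> = L * (x n - real d - 3) ^ d - fact d * ln (real n + 1)"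
      using elim(2) by (simp add: power_divide field_simps)
    finally show ?case by simp
  qed
qed

text \<open>A simplex of size about \<open>x n\<close> yields a logarithm of about
  \<open>L * x n ^ d / fact d\<close>, and \<open>x n ^ d / fact d\<close> is exactly the
  coefficient of \<open>\<delta>\<close>. Positivity of the count is recorded for the upper
  bound.\<close>

lemma eventually_ln_num_partitions_ge:
  fixes \<delta> :: real
  assumes d: "1 \<le> d" and \<delta>: "\<delta> < ln (2 + 1 / 2 ^ d)"
  shows "\<forall>\<^sub>F n in sequentially. 0 < num_partitions d n \<and>
    (real d + 1) / (fact (d + 1) powr (1 / (real d + 1))) * \<delta> * real n powr (real d / (real d + 1))
      \<le> ln (real (num_partitions d n))"
proof -
  define L :: real where "L = ln (2 + 1 / 2 ^ d)"
  define x where "x = (\<lambda>n. (fact (d + 1) * real n) powr (1 / (real d + 1)))"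
  have "filterlim x at_top sequentially"
  proof -
    have "0 < 1 / (real d + 1)" by simp
    then show ?thesis unfolding x_def by real_asymp
  qed
  then have "\<forall>\<^sub>F n in sequentially. real d + 3 \<le> x n"
    by (simp add: filterlim_at_top)
  moreover have "\<forall>\<^sub>F n in sequentially.
      \<delta> * x n ^ d + fact d * ln (real n + 1) \<le> L * (x n - real d - 3) ^ d"
    unfolding x_def L_def by (rule eventually_lower_bound[OF d \<delta>])
  ultimately show ?thesis
    using eventually_gt_at_top[of 0]
  proof eventually_elim
    case (elim n)
    \<comment> \<open>The offset \<open>2\<close> gives \<open>M + 2 \<le> x n\<close>, which keeps
      the volume bound \<open>(M + 2) choose (d + 1)\<close> at most \<open>n\<close>.\<close>
    define M where "M = nat \<lfloor>x n\<rfloor> - 2"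
    have n: "0 < n" using elim by simp
    have M2: "real (M + 2) \<le> x n" "x n - 3 \<le> real M"
      using elim(1) by (auto simp: M_def) linarith+
    have xpow: "x n ^ (d + 1) = fact (d + 1) * real n"
      using n by (simp add: x_def powr_realpow[symmetric] powr_powr add.commute del: fact_Suc power_Suc)
    have "real (((M + 2) choose (d + 1)) * fact (d + 1)) \<le> real (M + 2) ^ (d + 1)"
      using binomial_fact_pow[of "M + 2" "d + 1"] by (metis of_nat_le_iff of_nat_power of_nat_fact)
    also have "\<dots> \<le> x n ^ (d + 1)" using M2(1) by (intro power_mono) auto
    also have "\<dots> = real (n * fact (d + 1))" by (simp only: xpow of_nat_mult of_nat_fact mult.commute)
    finally have "(M + 2) choose (d + 1) \<le> n"
      by (simp only: of_nat_le_iff mult_le_cancel2 fact_gt_zero)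
    from power_card_corner_simplex_le[OF this]
    have *: "(2 + 1 / 2 ^ d) ^ (M choose d) \<le> (real n + 1) * real (num_partitions d n)" .
    moreover have "0 < (2 + 1 / 2 ^ d :: real) ^ (M choose d)"
      by (intro zero_less_power add_pos_pos) auto
    ultimately have pos: "0 < num_partitions d n"
      by (metis gr0I leD mult_zero_right of_nat_0)
    have L0: "0 \<le> L" by (simp add: L_def)
    have "real (M choose d) * L = ln ((2 + 1 / 2 ^ d) ^ (M choose d))"
      by (simp add: L_def ln_realpow add_pos_pos)
    also have "\<dots> \<le> ln ((real n + 1) * real (num_partitions d n))"
      using * by (intro ln_mono) (auto simp: add_pos_pos)
    also have "\<dots> = ln (real n + 1) + ln (real (num_partitions d n))"
      using pos by (simp add: ln_mult)
    finally have A: "real (M choose d) * L \<le> ln (real n + 1) + ln (real (num_partitions d n))" .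
    \<comment> \<open>Rounding and the offset cost at most \<open>3\<close>, and comparing
      \<open>M choose d\<close> with a power costs \<open>d\<close>.\<close>
    have "x n - real d - 3 \<le> real (M - d)" using M2(2) by linarith
    then have "(x n - real d - 3) ^ d \<le> real (M - d) ^ d"
      using elim(1) by (intro power_mono) auto
    also have "\<dots> \<le> real (M choose d) * fact d"
      using power_le_binomial_mult_fact[of M d] by (metis of_nat_le_iff of_nat_power of_nat_fact of_nat_mult)
    finally have "L * (x n - real d - 3) ^ d \<le> L * (real (M choose d) * fact d)"
      using L0 by (rule mult_left_mono)
    also have "\<dots> \<le> (ln (real n + 1) + ln (real (num_partitions d n))) * fact d"
      using mult_right_mono[OF A, of "fact d"] by (simp add: mult_ac)
    finally have "\<delta> * x n ^ d \<le> ln (real (num_partitions d n)) * fact d"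
      using elim(2) by (simp add: algebra_simps)
    then have B: "\<delta> * (x n ^ d / fact d) \<le> ln (real (num_partitions d n))"
      by (simp add: pos_divide_le_eq)
    have x0: "0 < x n" using elim(1) by linarith
    let ?y = "fact (d + 1) powr (1 / (real d + 1)) :: real"
    let ?w = "real n powr (real d / (real d + 1))"
    \<comment> \<open>Multiplying through by \<open>x n\<close> reduces this to
      \<open>x n ^ (d + 1) = fact (d + 1) * n\<close>.\<close>
    have C: "x n ^ d / fact d = (real d + 1) / ?y * ?w"
    proof -
      have x: "x n = ?y * real n powr (1 / (real d + 1))"
        by (simp only: x_def powr_mult)
      have "1 / (real d + 1) + real d / (real d + 1) = 1"
        by (simp add: field_simps)
      then have nn: "real n powr (1 / (real d + 1)) * ?w = real n"
        using n by (metis of_nat_0_le_iff powr_add powr_one)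
      have xp: "x n * x n ^ d = (real d + 1) * fact d * real n"
        using xpow by (simp add: mult_ac add_ac)
      have "x n * (x n ^ d * ?y) = (real d + 1) * fact d * (?y * real n)"
        unfolding mult.assoc[symmetric] xp by (simp only: mult_ac)
      also have "\<dots> = (real d + 1) * fact d * (?y * (real n powr (1 / (real d + 1)) * ?w))"
        by (simp only: nn)
      also have "\<dots> = x n * ((real d + 1) * fact d * ?w)"
        unfolding x by (simp only: mult_ac)
      finally have "x n ^ d * ?y = (real d + 1) * fact d * ?w" using x0 by simp
      moreover have "u / f = c / y * w" if "u * y = c * f * w" "0 < y" "0 < f"
        for u y c f w :: real
        using that by (simp add: field_simps)
      ultimately show ?thesis by simp
    qed
    have "(real d + 1) / ?y * \<delta> * ?w = \<delta> * (x n ^ d / fact d)"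
      unfolding C by (simp only: mult_ac)
    then show ?case using B pos by (simp only: simp_thms)
  qed
qed

theorem theorem1p1:
  fixes d :: nat
  assumes "d \<ge> 1"
  shows "\<exists>\<delta>::real. \<delta> > ln 2 \<and>
    (let \<alpha> = (real d + 1) / (fact (d + 1) powr (1 / (real d + 1))) * \<delta>;
         \<beta> = (real d + 1) * zeta (real d + 1) powr (1 / (real d + 1))
     in \<forall>\<^sub>F n in sequentially.
          \<alpha> * real n powr (real d / (real d + 1)) \<le> ln (real (num_partitions d n)) \<and>
          ln (real (num_partitions d n))
            \<le> \<beta> * real n powr (real d / (real d + 1)) + real d * ln (real n))"
proof -
  let ?L = "ln (2 + 1 / 2 ^ d) :: real"
  have "ln 2 < ?L" by (subst ln_less_cancel_iff) (auto simp: add_pos_pos)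
  \<comment> \<open>Room is kept on both sides: above \<open>ln 2\<close> for the claim, below
    \<open>?L\<close> to absorb the lower-order losses.\<close>
  then obtain \<delta> where \<delta>: "ln 2 < \<delta>" "\<delta> < ?L" using dense by blast
  show ?thesis unfolding Let_def
  proof (intro exI conjI)
    show "\<forall>\<^sub>F n in sequentially.
        (real d + 1) / (fact (d + 1) powr (1 / (real d + 1))) * \<delta> * real n powr (real d / (real d + 1))
          \<le> ln (real (num_partitions d n)) \<and>
        ln (real (num_partitions d n))
          \<le> (real d + 1) * zeta (real d + 1) powr (1 / (real d + 1)) * real n powr (real d / (real d + 1))
            + real d * ln (real n)"
      using eventually_ln_num_partitions_ge[OF assms \<delta>(2)] eventually_gt_at_top[of 0]
    proof eventually_elim
      case (elim n)
      have "0 \<le> real d * ln (real n)" using elim(2) by simp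
      then show ?case using elim ln_num_partitions_le[OF assms, of n] by linarith
    qed
  qed (fact \<delta>(1))
qed

end
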